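(* Let $c_1,c_2\ge0$, $b_1,b_2>0$, let $D=[c_1,c_1+b_1]\times[c_2,c_2+b_2]$, and let the buyer's valuation $z$ be uniformly distributed on $D$. Suppose $c_2\le b_2$ and $c_1\ge 2b_1\big(b_2/(b_2-c_2)\big)^2$ (the right-hand side being $+\infty$ when $c_2=b_2$, so that necessarily $c_2<b_2$). Then the optimal mechanism is the following: a buyer with $z_2<(c_2+b_2)/2$ receives the allocation $(1,0)$ and pays $c_1$, and a buyer with $z_2\ge(c_2+b_2)/2$ receives the allocation $(1,1)$ and pays $c_1+(c_2+b_2)/2$.
   Context: A seller sells two items to one buyer with valuation $z=(z_1,z_2)\in D$. A (direct) mechanism is a pair of an allocation function $q:D\to[0,1]^2$ and a payment function $t:D\to\mathbb{R}_{\ge0}$. It is incentive compatible if $z\cdot q(z)-t(z)\ge z\cdot q(\hat z)-t(\hat z)$ for all $z,\hat z\in D$, and individually rational if $z\cdot q(z)-t(z)\ge0$ for all $z\in D$. A mechanism is optimal if it maximizes the expected revenue $\mathbb{E}[t(z)]$ among all incentive compatible and individually rational mechanisms. "The optimal mechanism is X" means that mechanism X is optimal. *)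

theory Defs
  imports "HOL-Probability.Probability"
begin

text \<open>
  A valuation is a point of \<open>real \<times> real\<close>, so the value of an allocation is the inner product
  \<open>z \<bullet> q z\<close>.  A mechanism is a pair \<open>(q, t)\<close> of total functions; their values outside the set
  \<open>D\<close> of valuations play no role in any of the definitions.
\<close>

type_synonym mechanism = "(real \<times> real \<Rightarrow> real \<times> real) \<times> (real \<times> real \<Rightarrow> real)"

definition is_mechanism :: "(real \<times> real) set \<Rightarrow> mechanism \<Rightarrow> bool" where
  "is_mechanism D = (\<lambda>(q, t). (\<forall>z\<in>D. q z \<in> {0..1} \<times> {0..1}) \<and> (\<forall>z\<in>D. t z \<ge> 0))"

definition incentive_compatible :: "(real \<times> real) set \<Rightarrow> mechanism \<Rightarrow> bool" where
  "incentive_compatible D = (\<lambda>(q, t). \<forall>z\<in>D. \<forall>z'\<in>D. z \<bullet> q z - t z \<ge> z \<bullet> q z' - t z')"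

definition individually_rational :: "(real \<times> real) set \<Rightarrow> mechanism \<Rightarrow> bool" where
  "individually_rational D = (\<lambda>(q, t). \<forall>z\<in>D. z \<bullet> q z - t z \<ge> 0)"

text \<open>
  The uniform distribution lives on the Lebesgue (not Borel) measurable subsets of \<open>D\<close>, and the
  underlying space is \<open>D\<close> itself.  This matters because the Bochner integral of a non-measurable
  function is 0.  On a rectangle, the payment of an incentive compatible mechanism is determined,
  almost everywhere, by the convex utility \<open>z \<bullet> q z - t z\<close> and its gradient; hence it is always
  Lebesgue measurable, although it need not be Borel measurable.  Individual rationality bounds it.
  So the integral below is the expected revenue of every mechanism that is compared, without any
  measurability assumption on mechanisms.
\<close>

definition uniform_on :: "(real \<times> real) set \<Rightarrow> (real \<times> real) measure" where
  "uniform_on D = uniform_measure (lebesgue_on D) D"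

definition expected_revenue :: "(real \<times> real) measure \<Rightarrow> mechanism \<Rightarrow> real" where
  "expected_revenue M = (\<lambda>(q, t). \<integral>z. t z \<partial>M)"

definition optimal_mechanism ::
    "(real \<times> real) set \<Rightarrow> (real \<times> real) measure \<Rightarrow> mechanism \<Rightarrow> bool" where
  "optimal_mechanism D M m \<longleftrightarrow>
     is_mechanism D m \<and> incentive_compatible D m \<and> individually_rational D m \<and>
     (\<forall>m'. is_mechanism D m' \<and> incentive_compatible D m' \<and> individually_rational D m' \<longrightarrow>
           expected_revenue M m' \<le> expected_revenue M m)"

end

theory Submission
  imports Defs
begin

text \<open>
  Let \<open>U\<close> be the convex utility of a mechanism, \<open>C = c1 / b1\<close>, \<open>P = (c2 + b2) / 2\<close> and
  \<open>M = c2 + b2 / C \<le> P\<close>. The revenue density is \<open>x U\<^sub>x + y U\<^sub>y - U\<close>.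
  In \<open>x U\<^sub>x = c1 U\<^sub>x + (x - c1) U\<^sub>x\<close> the second term is at most \<open>x - c1\<close>. The integral of \<open>U\<^sub>x\<close>
  along a horizontal line is at most \<open>b1\<close>, and, since \<open>0 \<le> U\<close> and \<open>U\<^sub>x \<le> 1\<close>, also at most \<open>b1 / 2\<close>
  plus the mean of \<open>U\<close> on that line; the latter bound is used for \<open>y < M\<close>, the former for \<open>y \<ge> M\<close>.
  This leaves, on every vertical line, the integral of \<open>y k' - k\<close> plus \<open>C\<close> times the integral of
  \<open>k\<close> over \<open>{c2..M}\<close>, for the convex function \<open>k = U (x, _)\<close>. Integration by parts turns it into the
  integral of \<open>k'\<close> against the weight \<open>2 (y - P) + C max 0 (M - y)\<close>; \<open>M\<close> is chosen such that the boundary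
  terms cancel. On \<open>{c2..P}\<close> this weight changes sign once, from plus to minus, and the hypothesis on
  \<open>c1\<close> says exactly that its integral there is nonpositive. As \<open>k'\<close> is nondecreasing with values in
  \<open>{0..1}\<close>, the integral is at most \<open>P\<^sup>2\<close>. All bounds are attained by the claimed mechanism.

  Derivatives of \<open>U\<close> are replaced by difference quotients with step \<open>\<epsilon>\<close>. They bound the payment
  from above and are continuous, so neither differentiability of \<open>U\<close> nor measurability of the
  allocation is needed.
\<close>

section \<open>Vertical lines: bounds for convex utilities of one variable\<close>

text \<open>After integration by parts, \<open>s\<close> is compared with its value \<sigma> at the
  sign change of the weight on \<open>{c..P}\<close>: where the weight is nonnegative,
  \<open>s\<close> is at most \<sigma>, and where it is nonpositive, \<open>s\<close> is at least
  \<sigma>. So that part is at most \<sigma> times the integral of the weight, which is nonpositive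
  by the hypothesis on \<open>C\<close>. On \<open>{P..c + B}\<close> the weight is nonnegative and
  \<open>s\<close> at most 1, which leaves \<open>P\<^sup>2\<close>.\<close>

lemma convex_utility_revenue_bound_C1:
  fixes c B C :: real and G s :: "real \<Rightarrow> real"
  defines "P \<equiv> (c + B) / 2" and "M \<equiv> c + B / C"
  assumes "0 \<le> c" "c < B" and C: "2 * (B / (B - c))\<^sup>2 \<le> C"
    and G: "\<And>y. y \<in> {c..c + B} \<Longrightarrow> (G has_real_derivative s y) (at y within {c..c + B})"
    and s: "continuous_on {c..c + B} s" "mono_on {c..c + B} s" "\<And>y. y \<in> {c..c + B} \<Longrightarrow> s y \<in> {0..1}"
  shows "integral {c..c + B} (\<lambda>y. y * s y - G y) + C * integral {c..M} G \<le> P\<^sup>2"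
proof -
  have B: "B > 0" using assms by simp
  have "2 * 1 \<le> 2 * (B / (B - c))\<^sup>2"
    using assms by (intro mult_left_mono) (auto intro!: one_le_power simp: field_simps)
  then have C2: "C \<ge> 2" using C by simp
  have C': "2 * B\<^sup>2 \<le> C * (B - c)\<^sup>2"
    using C assms by (simp add: power_divide pos_divide_le_eq)
  have CP: "B\<^sup>2 / (2 * C) \<le> (P - c)\<^sup>2"
    using C' C2 by (simp add: P_def field_simps power2_eq_square)
  \<comment> \<open>The claim amounts to \<open>2 * B \<le> C * (B - c)\<close>; it follows from
    \<open>C'\<close> by enlarging one factor \<open>B - c\<close> to \<open>B\<close>.\<close>
  have MP: "M \<le> P"
  proof -
    have "2 * (B * B) \<le> C * ((B - c) * (B - c))" using C' by (simp add: power2_eq_square)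
    also have "\<dots> \<le> C * ((B - c) * B)"
      using assms C2 by (intro mult_left_mono) auto
    finally have "B * (2 * B) \<le> B * (C * (B - c))" by (simp add: algebra_simps)
    then have "2 * B \<le> C * (B - c)" using B by (simp only: mult_le_cancel_left_pos)
    then show ?thesis using C2 by (simp add: M_def P_def field_simps)
  qed
  have ord: "c < M" "P < c + B" "M \<le> c + B" using assms C2 B MP by (auto simp: M_def P_def field_simps)
  have contG: "continuous_on {c..c + B} G"
    using G by (meson DERIV_continuous continuous_on_eq_continuous_within)
  have sub: "{c..M} \<subseteq> {c..c + B}" "{M..P} \<subseteq> {c..c + B}" "{P..c + B} \<subseteq> {c..c + B}"
    using ord MP by auto
  note cs = continuous_on_subset[OF s(1) sub(1)] continuous_on_subset[OF s(1) sub(2)] continuous_on_subset[OF s(1) sub(3)] s(1)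
  note cG = continuous_on_subset[OF contG sub(1)] contG
  note integ = integrable_continuous_real
  define h where "h y = 2 * (y - P) * s y" for y
  \<comment> \<open>The antiderivative \<open>(y - (c + B)) * G y\<close> vanishes at the upper end,
    so only the value at \<open>c\<close> survives. Since \<open>2 * P = c + B\<close>, the weight
    of \<open>s\<close> becomes \<open>2 * (y - P)\<close>.\<close>
  have ibp1: "integral {c..c + B} (\<lambda>y. y * s y - G y) = integral {c..c + B} h - B * G c"
  proof -
    have "((\<lambda>y. G y + (y - (c + B)) * s y) has_integral
        ((c + B) - (c + B)) * G (c + B) - (c - (c + B)) * G c) {c..c + B}"
      using B by (intro fundamental_theorem_of_calculus)
        (auto intro!: derivative_eq_intros G simp: has_real_derivative_iff_has_vector_derivative[symmetric])
    then have "integral {c..c + B} (\<lambda>y. G y + (y - (c + B)) * s y) = B * G c"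
      by (simp add: integral_unique)
    moreover have "integral {c..c + B} (\<lambda>y. h y - (G y + (y - (c + B)) * s y)) =
        integral {c..c + B} h - integral {c..c + B} (\<lambda>y. G y + (y - (c + B)) * s y)"
      unfolding h_def by (intro integral_diff integ continuous_intros cs cG)
    moreover have "(\<lambda>y. h y - (G y + (y - (c + B)) * s y)) = (\<lambda>y. y * s y - G y)"
      by (auto simp: h_def P_def algebra_simps)
    ultimately show ?thesis by simp
  qed
  \<comment> \<open>Here \<open>(M - y) * G y\<close> vanishes at \<open>M\<close>. As
    \<open>C * (M - c) = B\<close>, the remaining boundary term is the one of \<open>ibp1\<close>
    with the opposite sign.\<close>
  have ibp2: "C * integral {c..M} G = integral {c..M} (\<lambda>y. C * (M - y) * s y) + B * G c"
  proof -
    have "((\<lambda>y. (M - y) * s y - G y) has_integral (M - M) * G M - (M - c) * G c) {c..M}"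
      using ord by (intro fundamental_theorem_of_calculus)
        (auto intro!: derivative_eq_intros DERIV_subset[OF G] sub simp: has_real_derivative_iff_has_vector_derivative[symmetric])
    then have "integral {c..M} (\<lambda>y. (M - y) * s y - G y) = - (B / C * G c)"
      by (simp add: integral_unique M_def)
    moreover have "integral {c..M} (\<lambda>y. (M - y) * s y - G y) =
        integral {c..M} (\<lambda>y. (M - y) * s y) - integral {c..M} G"
      by (intro integral_diff integ continuous_intros cs cG)
    ultimately have "C * integral {c..M} G = C * (integral {c..M} (\<lambda>y. (M - y) * s y) + B / C * G c)"
      by simp
    also have "\<dots> = integral {c..M} (\<lambda>y. C * ((M - y) * s y)) + B * G c"
      using C2 by (simp add: distrib_left)
    finally show ?thesis by (simp add: mult.assoc)
  qed
  have hint: "h integrable_on {c..c + B}" "h integrable_on {c..P}" "h integrable_on {c..M}"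
    unfolding h_def using ord MP
    by (auto intro!: integ continuous_intros continuous_on_subset[OF s(1)])
  have split: "integral {c..c + B} h = integral {c..M} h + integral {M..P} h + integral {P..c + B} h"
    using Henstock_Kurzweil_Integration.integral_combine[OF _ _ hint(1), of P] Henstock_Kurzweil_Integration.integral_combine[OF _ _ hint(2), of M] ord MP by simp
  \<comment> \<open>The weight of \<open>s\<close> is affine on \<open>{c..M}\<close>, starts at \<open>c \<ge> 0\<close>, and changes sign only at \<open>z\<close>.\<close>
  define z where "z = c + c / (C - 2)"
  have aff: "2 * (y - P) + C * (M - y) = c - (C - 2) * (y - c)" for y
    using C2 by (simp add: P_def M_def field_simps)
  \<comment> \<open>For \<open>C = 2\<close> the quotient \<open>c / (C - 2)\<close> is 0 by
    convention, hence \<open>z = c\<close>. As \<open>c = 0\<close>, the weight then vanishes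
    identically on \<open>{c..M}\<close>, and \<open>z\<close> still serves as its sign
    change.\<close>
  have C2c: "c = 0" if "C = 2"
  proof -
    have "c * (2 * B - c) \<le> 0" using C' that by (simp add: power2_eq_square algebra_simps)
    then show ?thesis using assms by (simp add: mult_le_0_iff)
  qed
  \<comment> \<open>At \<open>M\<close> the weight is \<open>2 * (M - P)\<close>, which is
    nonpositive, so the sign has changed by then.\<close>
  have zM: "z \<in> {c..M}"
  proof -
    have "c \<le> (C - 2) * (M - c)" using aff[of M] MP by simp
    then show ?thesis using C2 C2c assms ord
      by (cases "C = 2") (auto simp: z_def field_simps)
  qed
  then have zI: "z \<in> {c..c + B}" using sub by auto
  define \<sigma> where "\<sigma> = s z"
  have \<sigma>: "0 \<le> \<sigma>" using s(3) zI by (auto simp: \<sigma>_def)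
  have i1: "integral {c..M} (\<lambda>y. h y + C * (M - y) * s y) \<le> \<sigma> * (c * (M - c) - (C - 2) * (M - c)\<^sup>2 / 2)"
  proof -
    have "((\<lambda>y. (c - (C - 2) * (y - c)) * \<sigma>) has_integral
       \<sigma> * (c * (M - c) - (C - 2) * (M - c)\<^sup>2 / 2) - \<sigma> * (c * (c - c) - (C - 2) * (c - c)\<^sup>2 / 2)) {c..M}"
      using ord by (intro fundamental_theorem_of_calculus)
        (auto intro!: derivative_eq_intros simp: has_real_derivative_iff_has_vector_derivative[symmetric])
    moreover have "h y + C * (M - y) * s y \<le> (c - (C - 2) * (y - c)) * \<sigma>" if y: "y \<in> {c..M}" for y
    proof -
      have "h y + C * (M - y) * s y = (c - (C - 2) * (y - c)) * s y"
        unfolding h_def aff[symmetric] by (simp only: distrib_right)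
      also have "\<dots> \<le> (c - (C - 2) * (y - c)) * \<sigma>"
      proof (cases "y \<le> z")
        case True
        have "s y \<le> \<sigma>" unfolding \<sigma>_def using True y zI sub by (intro mono_onD[OF s(2)]) auto
        moreover have "(C - 2) * (y - c) \<le> c"
          using True C2 C2c assms by (cases "C = 2") (auto simp: z_def field_simps)
        ultimately show ?thesis by (intro mult_left_mono) auto
      next
        case False
        have "\<sigma> \<le> s y" unfolding \<sigma>_def using False y zI sub by (intro mono_onD[OF s(2)]) auto
        moreover have "c \<le> (C - 2) * (y - c)"
          using False C2 C2c assms by (cases "C = 2") (auto simp: z_def field_simps)
        ultimately show ?thesis by (intro mult_left_mono_neg) auto
      qed
      finally show ?thesis .
    qed
    moreover have "(\<lambda>y. h y + C * (M - y) * s y) integrable_on {c..M}"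
      unfolding h_def by (intro integ continuous_intros cs)
    ultimately show ?thesis
      by (intro has_integral_le[OF integrable_integral]) auto
  qed
  have i2: "integral {M..P} h \<le> - \<sigma> * (M - P)\<^sup>2"
  proof -
    have "((\<lambda>y. 2 * (y - P) * \<sigma>) has_integral \<sigma> * (P - P)\<^sup>2 - \<sigma> * (M - P)\<^sup>2) {M..P}"
      using MP by (intro fundamental_theorem_of_calculus)
        (auto intro!: derivative_eq_intros simp: has_real_derivative_iff_has_vector_derivative[symmetric])
    moreover have "h y \<le> 2 * (y - P) * \<sigma>" if y: "y \<in> {M..P}" for y
    proof -
      have "\<sigma> \<le> s y" unfolding \<sigma>_def using y zI zM sub by (intro mono_onD[OF s(2)]) auto
      then show ?thesis unfolding h_def using y by (intro mult_left_mono_neg) auto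
    qed
    moreover have "h integrable_on {M..P}"
      unfolding h_def by (intro integ continuous_intros cs)
    ultimately show ?thesis
      by (intro has_integral_le[OF integrable_integral]) auto
  qed
  have i3: "integral {P..c + B} h \<le> P\<^sup>2"
  proof -
    have "((\<lambda>y. 2 * (y - P)) has_integral (c + B - P)\<^sup>2 - (P - P)\<^sup>2) {P..c + B}"
      using ord by (intro fundamental_theorem_of_calculus)
        (auto intro!: derivative_eq_intros simp: has_real_derivative_iff_has_vector_derivative[symmetric])
    moreover have "h y \<le> 2 * (y - P)" if y: "y \<in> {P..c + B}" for y
    proof -
      have "s y \<le> 1" using s(3)[of y] y sub by auto
      then have "h y \<le> 2 * (y - P) * 1" unfolding h_def using y by (intro mult_left_mono) auto
      then show ?thesis by simp
    qed
    moreover have "h integrable_on {P..c + B}"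
      unfolding h_def by (intro integ continuous_intros cs)
    ultimately have "integral {P..c + B} h \<le> (c + B - P)\<^sup>2 - (P - P)\<^sup>2"
      by (intro has_integral_le[OF integrable_integral]) auto
    moreover have "c + B - P = P" by (simp add: P_def field_simps)
    ultimately show ?thesis by simp
  qed
  \<comment> \<open>The left side is the integral of the weight over \<open>{c..P}\<close>, the
    total coefficient of \<sigma> in \<open>i1\<close> and \<open>i2\<close>; \<open>CP\<close>
    makes it nonpositive.\<close>
  have "c * (M - c) - (C - 2) * (M - c)\<^sup>2 / 2 - (M - P)\<^sup>2 = B\<^sup>2 / (2 * C) - (P - c)\<^sup>2"
    using C2 by (simp add: P_def M_def field_simps power2_eq_square)
  then have neg: "\<sigma> * (c * (M - c) - (C - 2) * (M - c)\<^sup>2 / 2 - (M - P)\<^sup>2) \<le> 0"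
    using CP \<sigma> by (simp add: mult_le_0_iff)
  have "integral {c..M} (\<lambda>y. h y + C * (M - y) * s y) =
      integral {c..M} h + integral {c..M} (\<lambda>y. C * (M - y) * s y)"
    using hint by (intro integral_add) (auto intro!: integ continuous_intros cs)
  then show ?thesis
    using ibp1 ibp2 split i1 i2 i3 neg by (simp add: algebra_simps)
qed

text \<open>Supplies the smoothing used below: the quotient of \<open>K\<close> is the average of
  \<open>f\<close> over \<open>{x..x + h}\<close>. By the mean value theorem it is a value of
  \<open>f\<close> inside this interval.\<close>

lemma antiderivative_nondecreasing_Lipschitz:
  fixes f :: "real \<Rightarrow> real"
  assumes cont: "continuous_on UNIV f" and lip: "\<And>x h. 0 \<le> h \<Longrightarrow> f x \<le> f (x + h) \<and> f (x + h) \<le> f x + h"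
  obtains K where "\<And>x. (K has_real_derivative f x) (at x)"
    and "\<And>x h. 0 < h \<Longrightarrow> f x \<le> (K (x + h) - K x) / h \<and> (K (x + h) - K x) / h \<le> f x + h"
proof -
  have "isCont f x" for x using cont continuous_on_eq_continuous_at by blast
  then obtain K where "\<And>x. (K has_vector_derivative f x) (at x)"
    using einterval_antiderivative[of "-\<infinity>" "\<infinity>" f] by auto
  then have K: "(K has_real_derivative f x) (at x)" for x
    by (simp add: has_real_derivative_iff_has_vector_derivative)
  have "f x \<le> (K (x + h) - K x) / h \<and> (K (x + h) - K x) / h \<le> f x + h" if h: "0 < h" for x h
  proof -
    obtain z where z: "z > x" "z < x + h" "K (x + h) - K x = h * f z"
      using MVT2[of x "x + h" K f] K h by auto
    then have "(K (x + h) - K x) / h = f z" using h by simp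
    then show ?thesis using lip[of "z - x" x] z by auto
  qed
  with K show thesis by (rule that)
qed

text \<open>Both \<open>x + h\<close> and \<open>y\<close> are convex combinations of
  \<open>x\<close> and \<open>y + h\<close>, with weights interchanged. Adding the two convexity
  inequalities gives the claim.\<close>

lemma convex_on_increment_mono:
  fixes f :: "real \<Rightarrow> real"
  assumes f: "convex_on UNIV f" and "x \<le> y" "0 < h"
  shows "f (x + h) - f x \<le> f (y + h) - f y"
proof -
  define l where "l = h / (y - x + h)"
  have l: "0 \<le> l" "l \<le> 1" using assms by (auto simp: l_def)
  have lm: "l * (y - x + h) = h" using assms by (simp add: l_def)
  have e: "(1 - l) *\<^sub>R x + l *\<^sub>R (y + h) = x + h" "(1 - (1 - l)) *\<^sub>R x + (1 - l) *\<^sub>R (y + h) = y"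
    using lm by (simp_all add: algebra_simps)
  have "f (x + h) \<le> (1 - l) * f x + l * f (y + h)"
    using convex_onD[OF f l, of x "y + h"] unfolding e by simp
  moreover have "f y \<le> l * f x + (1 - l) * f (y + h)"
    using convex_onD[OF f, of "1 - l" x "y + h"] l unfolding e by simp
  ultimately show ?thesis by (simp add: algebra_simps)
qed

text \<open>The smooth bound is applied to a moving average of \<open>f\<close>. The average lies
  between \<open>f\<close> and \<open>f + \<epsilon>\<close>: the lower estimate handles the term
  with \<open>C\<close>, the upper one costs \<open>B * \<epsilon>\<close>.\<close>

lemma convex_utility_revenue_bound:
  fixes c B C \<epsilon> :: real and f :: "real \<Rightarrow> real"
  defines "P \<equiv> (c + B) / 2" and "M \<equiv> c + B / C"
  assumes cB: "0 \<le> c" "c < B" and C: "2 * (B / (B - c))\<^sup>2 \<le> C" "0 < C" and \<epsilon>: "0 < \<epsilon>"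
    and conv: "convex_on UNIV f" and lip: "\<And>x h. 0 \<le> h \<Longrightarrow> f x \<le> f (x + h) \<and> f (x + h) \<le> f x + h"
  shows "integral {c..c + B} (\<lambda>y. y * ((f (y + \<epsilon>) - f y) / \<epsilon>) - f y) + C * integral {c..M} f \<le> P\<^sup>2 + B * \<epsilon>"
proof -
  have cont: "continuous_on UNIV f"
    using conv by (intro convex_on_continuous) auto
  then have contf: "continuous_on A f" "continuous_on A (\<lambda>y. f (y + \<epsilon>))" for A
    using continuous_on_subset[OF cont] continuous_on_compose2[OF cont, of A "\<lambda>y. y + \<epsilon>"]
    by (simp_all add: continuous_on_add)
  obtain K where K: "\<And>x. (K has_real_derivative f x) (at x)"
    and Kq: "\<And>x h. 0 < h \<Longrightarrow> f x \<le> (K (x + h) - K x) / h \<and> (K (x + h) - K x) / h \<le> f x + h"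
    using antiderivative_nondecreasing_Lipschitz[OF cont lip] by metis
  \<comment> \<open>The average of \<open>f\<close> over \<open>{y..y + \<epsilon>}\<close> has the difference quotient of \<open>f\<close> as its derivative.\<close>
  define G where "G y = (K (y + \<epsilon>) - K y) / \<epsilon>" for y
  define s where "s y = (f (y + \<epsilon>) - f y) / \<epsilon>" for y
  have G: "(G has_real_derivative s y) (at y)" for y
    unfolding G_def s_def
    by (rule DERIV_cdivide[OF DERIV_diff[OF DERIV_shift[THEN iffD1, OF K] K]])
  then have contG: "continuous_on A G" for A
    by (meson DERIV_continuous continuous_at_imp_continuous_on)
  have conts: "continuous_on A s" for A
    unfolding s_def using \<epsilon> by (intro continuous_intros contf) auto
  have GB: "f y \<le> G y" "G y \<le> f y + \<epsilon>" for y
    using Kq[OF \<epsilon>] by (auto simp: G_def)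
  have main: "integral {c..c + B} (\<lambda>y. y * s y - G y) + C * integral {c..M} G \<le> P\<^sup>2"
    unfolding P_def M_def using cB C(1)
  proof (rule convex_utility_revenue_bound_C1)
    show "(G has_real_derivative s y) (at y within {c..c + B})" for y
      using G by (rule DERIV_subset) simp
    show "continuous_on {c..c + B} s" by (rule conts)
    show "mono_on {c..c + B} s"
      unfolding s_def using \<epsilon> by (intro mono_onI divide_right_mono convex_on_increment_mono conv) auto
    show "s y \<in> {0..1}" for y
      using lip[of \<epsilon> y] \<epsilon> by (auto simp: s_def)
  qed
  note integ = integrable_continuous_real continuous_intros conts contG contf
  have "integral {c..c + B} (\<lambda>y. y * s y - f y) \<le> integral {c..c + B} (\<lambda>y. (y * s y - G y) + \<epsilon>)"
    using GB(2) by (intro integral_le integ) (auto simp: algebra_simps)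
  also have "\<dots> = integral {c..c + B} (\<lambda>y. y * s y - G y) + B * \<epsilon>"
    using cB by (subst integral_add) (auto intro!: integ)
  finally have 1: "integral {c..c + B} (\<lambda>y. y * s y - f y) \<le> integral {c..c + B} (\<lambda>y. y * s y - G y) + B * \<epsilon>" .
  have "C * integral {c..M} f \<le> C * integral {c..M} G"
    using C GB(1) by (intro mult_left_mono integral_le integ) auto
  with 1 main show ?thesis by (simp add: s_def)
qed

section \<open>Horizontal lines: integrals of difference quotients\<close>

text \<open>The first bound holds because the quotient is at most 1. For the second, the integral
  telescopes to a difference of averages of \<open>f\<close> near \<open>a + b\<close> and
  \<open>a\<close>, which is at most \<open>f (a + b) + \<epsilon>\<close> because
  \<open>f a\<close> is nonnegative. Averaging \<open>f (a + b) \<le> f x + (a + b - x)\<close> over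
  \<open>x\<close> then bounds \<open>f (a + b)\<close>.\<close>

lemma increment_integral_bounds:
  fixes a b \<epsilon> :: real and f :: "real \<Rightarrow> real"
  assumes cont: "continuous_on UNIV f" and lip: "\<And>x h. 0 \<le> h \<Longrightarrow> f x \<le> f (x + h) \<and> f (x + h) \<le> f x + h"
    and "0 < b" "0 < \<epsilon>" "0 \<le> f a"
  defines "I \<equiv> integral {a..a + b} (\<lambda>x. (f (x + \<epsilon>) - f x) / \<epsilon>)"
  shows "I \<le> b" and "I \<le> b / 2 + integral {a..a + b} f / b + \<epsilon>"
proof -
  from cont have contf: "continuous_on A f" "continuous_on A (\<lambda>y. f (y + \<epsilon>))" for A
    using continuous_on_subset[OF cont] continuous_on_compose2[OF cont, of A "\<lambda>y. y + \<epsilon>"]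
    by (simp_all add: continuous_on_add)
  note integ = integrable_continuous_real continuous_intros contf
  have "(f (x + \<epsilon>) - f x) / \<epsilon> \<le> 1" for x
    using lip[of \<epsilon> x] assms(4) by (simp add: divide_le_eq)
  then have "I \<le> integral {a..a + b} (\<lambda>x. 1)"
    unfolding I_def using assms(4) by (intro integral_le integ) auto
  then show "I \<le> b" using assms by simp
  obtain K where K: "\<And>x. (K has_real_derivative f x) (at x)"
    and Kq: "\<And>x h. 0 < h \<Longrightarrow> f x \<le> (K (x + h) - K x) / h \<and> (K (x + h) - K x) / h \<le> f x + h"
    using antiderivative_nondecreasing_Lipschitz[OF cont lip] by metis
  define G where "G y = (K (y + \<epsilon>) - K y) / \<epsilon>" for y
  have G: "(G has_real_derivative (f (y + \<epsilon>) - f y) / \<epsilon>) (at y)" for y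
    unfolding G_def
    by (rule DERIV_cdivide[OF DERIV_diff[OF DERIV_shift[THEN iffD1, OF K] K]])
  have "((\<lambda>x. (f (x + \<epsilon>) - f x) / \<epsilon>) has_integral G (a + b) - G a) {a..a + b}"
    using assms by (intro fundamental_theorem_of_calculus)
      (auto simp: has_real_derivative_iff_has_vector_derivative[symmetric] intro: DERIV_subset[OF G])
  then have "I = G (a + b) - G a" unfolding I_def by (rule integral_unique)
  also have "\<dots> \<le> f (a + b) + \<epsilon>"
    using Kq[of \<epsilon> a] Kq[of \<epsilon> "a + b"] assms by (auto simp: G_def)
  finally have 1: "I \<le> f (a + b) + \<epsilon>" .
  have "((\<lambda>x. (a + b) - x) has_integral ((a + b) * (a + b) - (a + b)\<^sup>2 / 2) - ((a + b) * a - a\<^sup>2 / 2)) {a..a + b}"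
    using assms by (intro fundamental_theorem_of_calculus)
      (auto simp: has_real_derivative_iff_has_vector_derivative[symmetric] intro!: derivative_eq_intros)
  moreover have "((a + b) * (a + b) - (a + b)\<^sup>2 / 2) - ((a + b) * a - a\<^sup>2 / 2) = b\<^sup>2 / 2"
    by (simp add: power2_eq_square field_simps)
  ultimately have 2: "integral {a..a + b} (\<lambda>x. (a + b) - x) = b\<^sup>2 / 2"
    by (simp add: integral_unique)
  have "b * f (a + b) = integral {a..a + b} (\<lambda>x. f (a + b))" using assms by simp
  also have "\<dots> \<le> integral {a..a + b} (\<lambda>x. ((a + b) - x) + f x)"
  proof (intro integral_le integ)
    show "f (a + b) \<le> ((a + b) - x) + f x" if "x \<in> {a..a + b}" for x
      using lip[of "a + b - x" x] that by auto
  qed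
  also have "\<dots> = b\<^sup>2 / 2 + integral {a..a + b} f"
    unfolding 2[symmetric] by (intro integral_add integ)
  finally have "f (a + b) \<le> b / 2 + integral {a..a + b} f / b"
    using assms by (simp add: field_simps power2_eq_square)
  with 1 show "I \<le> b / 2 + integral {a..a + b} f / b + \<epsilon>" by simp
qed

section \<open>The indirect utility of a mechanism\<close>

text \<open>Unlike the utility \<open>z \<bullet> q z - t z\<close>, this extension is defined and convex on the whole plane.\<close>

definition indirect_utility :: "(real \<times> real) set \<Rightarrow> mechanism \<Rightarrow> real \<times> real \<Rightarrow> real" where
  "indirect_utility D = (\<lambda>(q, t) z. SUP z'\<in>D. z \<bullet> q z' - t z')"

context
  fixes D :: "(real \<times> real) set" and q t
  assumes ne: "D \<noteq> {}" and mech: "is_mechanism D (q, t)"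
begin

private abbreviation "U \<equiv> indirect_utility D (q, t)"

text \<open>Makes the supremum over reports meaningful at every point of the plane, also outside
  \<open>D\<close>.\<close>

lemma bdd_above_deviations: "bdd_above ((\<lambda>z'. z \<bullet> q z' - t z') ` D)"
proof (rule bdd_aboveI2)
  fix z' assume "z' \<in> D"
  then have "fst (q z') \<in> {0..1}" "snd (q z') \<in> {0..1}" "0 \<le> t z'"
    using mech by (auto simp: is_mechanism_def mem_Times_iff)
  moreover from this have "fst z * fst (q z') \<le> \<bar>fst z\<bar> * 1" "snd z * snd (q z') \<le> \<bar>snd z\<bar> * 1"
    by (intro mult_mono; simp)+
  ultimately show "z \<bullet> q z' - t z' \<le> \<bar>fst z\<bar> + \<bar>snd z\<bar>"
    by (simp add: inner_prod_def)
qed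

lemma indirect_utility_upper: "z' \<in> D \<Longrightarrow> z \<bullet> q z' - t z' \<le> U z"
  unfolding indirect_utility_def by (auto intro: cSUP_upper bdd_above_deviations)

lemma indirect_utility_least: "(\<And>z'. z' \<in> D \<Longrightarrow> z \<bullet> q z' - t z' \<le> a) \<Longrightarrow> U z \<le> a"
  unfolding indirect_utility_def using ne by (auto intro: cSUP_least)

lemma indirect_utility_eq: "incentive_compatible D (q, t) \<Longrightarrow> z \<in> D \<Longrightarrow> U z = z \<bullet> q z - t z"
  by (intro antisym indirect_utility_least indirect_utility_upper) (auto simp: incentive_compatible_def)

text \<open>Every affine function in the supremum has both slopes in \<open>{0..1}\<close>, and the
  supremum inherits the resulting bounds.\<close>

lemma indirect_utility_increment:
  assumes "0 \<le> fst h" "0 \<le> snd h"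
  shows "U z \<le> U (z + h)" "U (z + h) \<le> U z + fst h + snd h"
proof -
  have *: "0 \<le> h \<bullet> q z'" "h \<bullet> q z' \<le> fst h + snd h" if "z' \<in> D" for z'
  proof -
    have "fst (q z') \<in> {0..1}" "snd (q z') \<in> {0..1}"
      using mech that by (auto simp: is_mechanism_def mem_Times_iff)
    then have "fst h * fst (q z') \<le> fst h * 1" "snd h * snd (q z') \<le> snd h * 1"
      "0 \<le> fst h * fst (q z')" "0 \<le> snd h * snd (q z')"
      using assms by (auto intro!: mult_left_mono mult_nonneg_nonneg simp del: mult_1_right)
    then show "0 \<le> h \<bullet> q z'" "h \<bullet> q z' \<le> fst h + snd h"
      by (auto simp: inner_prod_def)
  qed
  show "U z \<le> U (z + h)"
  proof (rule indirect_utility_least)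
    fix z' assume "z' \<in> D"
    from *(1)[OF this] indirect_utility_upper[OF this, of "z + h"]
    show "z \<bullet> q z' - t z' \<le> U (z + h)" by (simp add: inner_add_left)
  qed
  show "U (z + h) \<le> U z + fst h + snd h"
  proof (rule indirect_utility_least)
    fix z' assume "z' \<in> D"
    from *(2)[OF this] indirect_utility_upper[OF this, of "z"]
    show "(z + h) \<bullet> q z' - t z' \<le> U z + fst h + snd h" by (simp add: inner_add_left)
  qed
qed

lemma convex_on_indirect_utility: "convex_on UNIV U"
proof (rule convex_onI)
  fix s :: real and x y :: "real \<times> real"
  assume s: "0 < s" "s < 1"
  show "U ((1 - s) *\<^sub>R x + s *\<^sub>R y) \<le> (1 - s) * U x + s * U y"
  proof (rule indirect_utility_least)
    fix z' assume z': "z' \<in> D"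
    have "((1 - s) *\<^sub>R x + s *\<^sub>R y) \<bullet> q z' - t z' = (1 - s) * (x \<bullet> q z' - t z') + s * (y \<bullet> q z' - t z')"
      by (simp add: inner_add_left algebra_simps)
    also have "\<dots> \<le> (1 - s) * U x + s * U y"
      using s z' by (intro add_mono mult_left_mono indirect_utility_upper) auto
    finally show "((1 - s) *\<^sub>R x + s *\<^sub>R y) \<bullet> q z' - t z' \<le> (1 - s) * U x + s * U y" .
  qed
qed simp

text \<open>The allocation is a subgradient of \<open>U\<close>, so each coordinate is at most the
  forward difference quotient. Splitting \<open>x\<close> into \<open>c + (x - c)\<close> gives the
  horizontal quotient a constant coefficient, so that its integral along a line can
  telescope.\<close>

lemma payment_le_difference_quotients:
  assumes ic: "incentive_compatible D (q, t)" and z: "(x, y) \<in> D"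
    and "0 \<le> c" "c \<le> x" "0 \<le> y" "0 < \<epsilon>"
  shows "t (x, y) \<le> c * ((U (x + \<epsilon>, y) - U (x, y)) / \<epsilon>) + (x - c)
    + (y * ((U (x, y + \<epsilon>) - U (x, y)) / \<epsilon>) - U (x, y))"
proof -
  obtain q1 q2 where q: "q (x, y) = (q1, q2)" by (cases "q (x, y)")
  have q1: "q1 \<le> 1" using mech z q by (force simp: is_mechanism_def)
  have U: "U (x, y) = x * q1 + y * q2 - t (x, y)"
    using indirect_utility_eq[OF ic z] by (simp add: q)
  \<comment> \<open>The shifted points may lie outside \<open>D\<close>; the inequalities hold
    because \<open>U\<close> is a supremum over reports at every point of the plane.\<close>
  have "(x + \<epsilon>) * q1 + y * q2 - t (x, y) \<le> U (x + \<epsilon>, y)" "x * q1 + (y + \<epsilon>) * q2 - t (x, y) \<le> U (x, y + \<epsilon>)"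
    using indirect_utility_upper[OF z, of "(x + \<epsilon>, y)"] indirect_utility_upper[OF z, of "(x, y + \<epsilon>)"]
    by (auto simp: q)
  then have "q1 \<le> (U (x + \<epsilon>, y) - U (x, y)) / \<epsilon>" "q2 \<le> (U (x, y + \<epsilon>) - U (x, y)) / \<epsilon>"
    using \<open>0 < \<epsilon>\<close> unfolding U by (auto simp: field_simps)
  then have "c * q1 \<le> c * ((U (x + \<epsilon>, y) - U (x, y)) / \<epsilon>)" "y * q2 \<le> y * ((U (x, y + \<epsilon>) - U (x, y)) / \<epsilon>)"
    using assms by (intro mult_left_mono; simp)+
  moreover have "(x - c) * q1 \<le> x - c"
    using mult_left_mono[OF q1, of "x - c"] assms by simp
  then have "x * q1 - c * q1 \<le> x - c" by (simp only: left_diff_distrib)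
  ultimately show ?thesis using U by linarith
qed

end

section \<open>Combination of both directions on the rectangle\<close>

text \<open>Horizontal lines contribute the integral \<open>J\<close> of \<open>U\<close> below
  height \<open>M\<close> with factor \<open>c1 / b\<close>, vertical lines contribute it with
  factor \<open>- C\<close>. With \<open>C = c1 / b\<close> the two cancel, and a bound independent
  of \<open>U\<close> remains.\<close>

lemma revenue_functional_bound:
  fixes U :: "real \<times> real \<Rightarrow> real" and b B c1 c2 \<epsilon> :: real
  defines "g \<equiv> \<lambda>(x, y). c1 * ((U (x + \<epsilon>, y) - U (x, y)) / \<epsilon>) + (x - c1)
    + (y * ((U (x, y + \<epsilon>) - U (x, y)) / \<epsilon>) - U (x, y))"
  assumes conv: "convex_on UNIV U"
    and incr: "\<And>z h. 0 \<le> fst h \<Longrightarrow> 0 \<le> snd h \<Longrightarrow> U z \<le> U (z + h) \<and> U (z + h) \<le> U z + fst h + snd h"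
    and nn: "\<And>y. y \<in> {c2..c2 + B} \<Longrightarrow> 0 \<le> U (c1, y)"
    and pos: "0 < b" "0 \<le> c2" "c2 < B" "0 < \<epsilon>"
    and c1: "2 * b * (B / (B - c2))\<^sup>2 \<le> c1"
  shows "continuous_on UNIV g"
    and "integral (cbox (c1, c2) (c1 + b, c2 + B)) g \<le> b * (B * c1 + ((c2 + B) / 2)\<^sup>2) + 2 * b * B * \<epsilon>"
proof -
  define C where "C = c1 / b"
  define M where "M = c2 + B / C"
  define P where "P = (c2 + B) / 2"
  have B: "0 < B" using pos by simp
  have C: "2 * (B / (B - c2))\<^sup>2 \<le> C" using c1 pos by (simp add: C_def field_simps)
  have "2 * 1 \<le> 2 * (B / (B - c2))\<^sup>2"
    using pos by (intro mult_left_mono) (auto intro!: one_le_power simp: field_simps)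
  then have C2: "2 \<le> C" using C by simp
  have Cb: "c1 = C * b" using pos by (simp add: C_def)
  have M: "c2 < M" "M \<le> c2 + B" using C2 B by (auto simp: M_def field_simps)
  have cont: "continuous_on UNIV U" using conv by (intro convex_on_continuous) auto
  have contU [continuous_intros]: "continuous_on A (\<lambda>z. U (f z, k z))"
    if "continuous_on A f" "continuous_on A k" for A :: "'x::topological_space set" and f k
    using that by (intro continuous_on_compose2[OF cont] continuous_intros) auto
  show "continuous_on UNIV g"
    unfolding g_def case_prod_beta using pos by (intro continuous_intros) auto
  have convy: "convex_on UNIV (\<lambda>y. U (x, y))" for x
  proof (rule convex_onI)
    fix s y y' :: real
    assume s: "0 < s" "s < 1"
    have "(1 - s) *\<^sub>R (x, y) + s *\<^sub>R (x, y') = (x, (1 - s) *\<^sub>R y + s *\<^sub>R y')"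
      by (simp add: algebra_simps)
    then show "U (x, (1 - s) *\<^sub>R y + s *\<^sub>R y') \<le> (1 - s) * U (x, y) + s * U (x, y')"
      using convex_onD[OF conv, of s "(x, y)" "(x, y')"] s by simp
  qed simp
  have lipx: "U (x, y) \<le> U (x + h, y) \<and> U (x + h, y) \<le> U (x, y) + h"
    and lipy: "U (x, y) \<le> U (x, y + h) \<and> U (x, y + h) \<le> U (x, y) + h" if "0 \<le> h" for x y h
    using incr[of "(h, 0)" "(x, y)"] incr[of "(0, h)" "(x, y)"] that by auto
  define R where "R = cbox (c1, c2) (c1 + b, c2 + B)"
  define d where "d = (\<lambda>(x, y). (U (x + \<epsilon>, y) - U (x, y)) / \<epsilon>)"
  define e where "e = (\<lambda>(x, y). y * ((U (x, y + \<epsilon>) - U (x, y)) / \<epsilon>) - U (x, y))"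
  have contd: "continuous_on A d" and conte: "continuous_on A e" for A
    unfolding d_def e_def case_prod_beta using pos by (intro continuous_intros; simp)+
  define N where "N y = integral {c1..c1 + b} (\<lambda>x. U (x, y))" for y
  define J where "J = integral {c2..M} N"
  \<comment> \<open>Exchanging the order of integration lets the same quantity be collected along
    horizontal and along vertical lines.\<close>
  have J: "J = integral {c1..c1 + b} (\<lambda>x. integral {c2..M} (\<lambda>y. U (x, y)))"
    unfolding J_def N_def
    using integral_swap_continuous[of c1 c2 "c1 + b" M "\<lambda>x y. U (x, y)"] continuous_on_subset[OF cont]
    by simp
  have param: "continuous_on A (\<lambda>u. integral {v..w} (k u))"
    if "continuous_on UNIV (\<lambda>(u, v). k u v)" for A v w and k :: "real \<Rightarrow> real \<Rightarrow> real"
    using integral_continuous_on_param[of A v w k] continuous_on_subset[OF that] by simp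
  have contN: "continuous_on A N" for A
    unfolding N_def case_prod_beta by (intro param) (auto simp: case_prod_beta intro!: continuous_intros)
  have d: "integral R d \<le> (b / 2 + \<epsilon>) * (M - c2) + J / b + b * (c2 + B - M)"
  proof -
    define I where "I = (\<lambda>y. integral {c1..c1 + b} (\<lambda>x. (U (x + \<epsilon>, y) - U (x, y)) / \<epsilon>))"
    have contI: "continuous_on A I" for A
      unfolding I_def using pos by (intro param) (auto simp: case_prod_beta intro!: continuous_intros)
    have "integral R d = integral {c1..c1 + b} (\<lambda>x. integral {c2..c2 + B} (\<lambda>y. d (x, y)))"
      unfolding R_def using integral_prod_continuous[OF contd] by simp
    also have "\<dots> = integral {c2..c2 + B} (\<lambda>y. integral {c1..c1 + b} (\<lambda>x. d (x, y)))"
      using integral_swap_continuous[of c1 c2 "c1 + b" "c2 + B" "\<lambda>x y. d (x, y)"] contd by simp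
    also have "\<dots> = integral {c2..c2 + B} I"
      by (simp only: d_def I_def case_prod_conv)
    also have "\<dots> = integral {c2..M} I + integral {M..c2 + B} I"
      using M contI by (intro Henstock_Kurzweil_Integration.integral_combine[symmetric] integrable_continuous_real) auto
    also have "integral {M..c2 + B} I \<le> integral {M..c2 + B} (\<lambda>y. b)"
    proof (intro integral_le integrable_continuous_real contI continuous_intros)
      fix y assume "y \<in> {M..c2 + B}"
      then show "I y \<le> b" unfolding I_def using M nn pos
        by (intro increment_integral_bounds(1)[OF _ lipx]) (auto intro!: continuous_intros)
    qed
    also have "integral {c2..M} I \<le> integral {c2..M} (\<lambda>y. (b / 2 + \<epsilon>) + N y / b)"
    proof (intro integral_le integrable_continuous_real contI continuous_intros contN)
      fix y assume "y \<in> {c2..M}"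
      then have "I y \<le> b / 2 + N y / b + \<epsilon>" unfolding I_def N_def using M nn pos
        by (intro increment_integral_bounds(2)[OF _ lipx]) (auto intro!: continuous_intros)
      then show "I y \<le> (b / 2 + \<epsilon>) + N y / b" by simp
    qed (use pos in auto)
    also have "\<dots> = integral {c2..M} (\<lambda>y. b / 2 + \<epsilon>) + J / b"
      unfolding J_def integral_divide[symmetric] using pos
      by (intro integral_add integrable_continuous_real continuous_intros contN) auto
    finally show ?thesis using M by (simp add: algebra_simps)
  qed
  have xx: "integral R (\<lambda>(x, y). x - c1) = B * b\<^sup>2 / 2"
  proof -
    have "((\<lambda>x. B * (x - c1)) has_integral (B * (c1 + b - c1)\<^sup>2 / 2 - B * (c1 - c1)\<^sup>2 / 2)) {c1..c1 + b}"
      using pos by (intro fundamental_theorem_of_calculus)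
        (auto simp: has_real_derivative_iff_has_vector_derivative[symmetric] intro!: derivative_eq_intros)
    then have "integral {c1..c1 + b} (\<lambda>x. B * (x - c1)) = B * (c1 + b - c1)\<^sup>2 / 2 - B * (c1 - c1)\<^sup>2 / 2"
      by (rule integral_unique)
    moreover have "integral R (\<lambda>(x, y). x - c1) = integral {c1..c1 + b} (\<lambda>x. integral {c2..c2 + B} (\<lambda>y. x - c1))"
      unfolding R_def by (subst integral_prod_continuous) (auto simp: case_prod_beta intro!: continuous_intros)
    ultimately show ?thesis using B by simp
  qed
  have e: "integral R e \<le> b * (P\<^sup>2 + B * \<epsilon>) - C * J"
  proof -
    have "integral R e = integral {c1..c1 + b} (\<lambda>x. integral {c2..c2 + B} (\<lambda>y. e (x, y)))"
      unfolding R_def using integral_prod_continuous[OF conte] by simp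
    also have "\<dots> \<le> integral {c1..c1 + b} (\<lambda>x. (P\<^sup>2 + B * \<epsilon>) - C * integral {c2..M} (\<lambda>y. U (x, y)))"
    proof (intro integral_le integrable_continuous_real continuous_intros param)
      fix x
      show "integral {c2..c2 + B} (\<lambda>y. e (x, y)) \<le> (P\<^sup>2 + B * \<epsilon>) - C * integral {c2..M} (\<lambda>y. U (x, y))"
        using convex_utility_revenue_bound[OF pos(2,3) C _ pos(4) convy[of x] lipy] C2
        by (simp add: e_def P_def M_def)
    qed (use conte cont in \<open>auto simp: case_prod_beta\<close>)
    also have "\<dots> = b * (P\<^sup>2 + B * \<epsilon>) - C * J"
      unfolding J using pos cont
      by (subst integral_diff) (auto intro!: integrable_continuous_real continuous_intros param simp: case_prod_beta)
    finally show ?thesis .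
  qed
  have cR: "continuous_on R (\<lambda>(x, y). x - c1)" by (auto simp: case_prod_beta intro!: continuous_intros)
  have "g = (\<lambda>z. c1 * d z + (case z of (x, y) \<Rightarrow> x - c1) + e z)"
    by (auto simp: g_def d_def e_def)
  then have "integral R g = integral R (\<lambda>z. c1 * d z + (case z of (x, y) \<Rightarrow> x - c1)) + integral R e"
    using contd conte cR unfolding R_def
    by (simp only:) (intro integral_add integrable_continuous continuous_intros)
  also have "integral R (\<lambda>z. c1 * d z + (case z of (x, y) \<Rightarrow> x - c1)) = c1 * integral R d + B * b\<^sup>2 / 2"
    unfolding xx[symmetric] using contd cR unfolding R_def
    by (subst integral_add) (auto intro!: integrable_continuous continuous_intros)
  also have "c1 * integral R d \<le> c1 * ((b / 2 + \<epsilon>) * (M - c2) + J / b + b * (c2 + B - M))"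
    using d Cb C2 pos by (intro mult_left_mono) auto
  \<comment> \<open>Uses \<open>c1 * (M - c2) = b * B\<close>. The resulting
    \<open>b * (b * B) / 2\<close> and the equal term from \<open>xx\<close> cancel
    \<open>- b * (b * B)\<close>; each direction leaves an error
    \<open>b * B * \<epsilon>\<close>.\<close>
  also have "\<dots> = (b / 2 + \<epsilon>) * (b * B) + C * J + b * (c1 * B - b * B)"
    using C2 pos unfolding M_def Cb by (simp add: field_simps)
  finally show "integral (cbox (c1, c2) (c1 + b, c2 + B)) g \<le> b * (B * c1 + ((c2 + B) / 2)\<^sup>2) + 2 * b * B * \<epsilon>"
    using e unfolding R_def P_def by (simp add: algebra_simps power2_eq_square)
qed

section \<open>Expected revenue and optimality\<close>

lemma integral_uniform_on:
  fixes f :: "real \<times> real \<Rightarrow> real"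
  assumes D: "D \<in> lmeasurable" "0 < measure lebesgue D" and f: "integrable (lebesgue_on D) f"
  shows "integrable (uniform_on D) f"
    and "integral\<^sup>L (uniform_on D) f = integral D f / measure lebesgue D"
proof -
  let ?m = "measure lebesgue D"
  have Dl: "D \<in> sets lebesgue" using D by blast
  have em: "emeasure (lebesgue_on D) D = ennreal ?m"
    using D Dl by (simp add: emeasure_restrict_space emeasure_eq_measure2)
  have [measurable]: "D \<in> sets (lebesgue_on D)"
    using sets.top[of "lebesgue_on D"] by simp
  have "uniform_on D = density (lebesgue_on D) (\<lambda>x. ennreal (1 / ?m))"
    unfolding uniform_on_def uniform_measure_def em
    using D(2) by (intro density_cong AE_I2) (measurable, auto simp flip: divide_ennreal)
  note U = this
  show "integrable (uniform_on D) f"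
    unfolding U using f D by (subst integrable_density) auto
  show "integral\<^sup>L (uniform_on D) f = integral D f / ?m"
    unfolding U using f D Dl
    by (subst integral_density) (auto simp: lebesgue_integral_eq_integral)
qed

theorem theorem7:
  fixes c1 c2 b1 b2 :: real and D :: "(real \<times> real) set"
    and q :: "real \<times> real \<Rightarrow> real \<times> real" and t :: "real \<times> real \<Rightarrow> real"
  assumes "c1 \<ge> 0" and "c2 \<ge> 0" and "b1 > 0" and "b2 > 0"
    and "D = {c1..c1 + b1} \<times> {c2..c2 + b2}"
    and "c2 < b2"
    and "c1 \<ge> 2 * b1 * (b2 / (b2 - c2))\<^sup>2"
    and "\<And>z. z \<in> D \<Longrightarrow> snd z < (c2 + b2) / 2 \<Longrightarrow> q z = (1, 0) \<and> t z = c1"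
    and "\<And>z. z \<in> D \<Longrightarrow> snd z \<ge> (c2 + b2) / 2 \<Longrightarrow> q z = (1, 1) \<and> t z = c1 + (c2 + b2) / 2"
  shows "optimal_mechanism D (uniform_on D) (q, t)"
proof -
  define P where "P = (c2 + b2) / 2"
  note low = assms(8)[folded P_def] and high = assms(9)[folded P_def]
  have P: "c2 \<le> P" "P \<le> c2 + b2" "0 \<le> P" "c2 + b2 - P = P" using assms(2,4,6) by (auto simp: P_def field_simps)
  have D: "D = cbox (c1, c2) (c1 + b1, c2 + b2)"
    using assms(5) by (simp add: cbox_Pair_eq)
  have Dm: "D \<in> lmeasurable" unfolding D by simp
  have mD: "measure lebesgue D = b1 * b2"
    using assms(3,4) by (simp add: D content_Pair)
  have m: "0 < measure lebesgue D" using assms(3,4) mD by simp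
  \<comment> \<open>The buyers of both items; the height of this rectangle is
    \<open>c2 + b2 - P = P\<close>.\<close>
  define E where "E = cbox (c1, P) (c1 + b1, c2 + b2)"
  have E: "E = {z \<in> D. P \<le> snd z}"
    using P by (auto simp: E_def D cbox_Pair_eq)
  have t: "t z = c1 + P * indicat_real E z" if "z \<in> D" for z
    using low[OF that] high[OF that] that by (cases "P \<le> snd z") (auto simp: E)
  have EL: "integrable (lebesgue_on D) (indicat_real E)" "integral D (indicat_real E) = b1 * P"
  proof -
    have "measure lebesgue E = b1 * P" using assms(3) P by (simp add: E_def content_Pair)
    moreover have "E \<in> lmeasurable" by (simp add: E_def)
    moreover have "E \<inter> D = E" "D \<inter> E = E" using E by auto
    ultimately show "integral D (indicat_real E) = b1 * P"
      using Equivalence_Lebesgue_Henstock_Integration.integral_indicator[of E D] by simp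
    from \<open>E \<in> lmeasurable\<close> show "integrable (lebesgue_on D) (indicat_real E)"
      using Dm \<open>D \<inter> E = E\<close> by (subst integrable_restrict_space)
        (auto simp: indicator_inter_arith[symmetric] fmeasurable_def intro!: integrable_real_indicator)
  qed
  have int: "integrable (lebesgue_on D) (\<lambda>z. c1 + P * indicat_real E z)"
    by (intro Bochner_Integration.integrable_add integrable_mult_right EL
        finite_measure.integrable_const finite_measure_lebesgue_on Dm)
  have "expected_revenue (uniform_on D) (q, t) = integral\<^sup>L (uniform_on D) (\<lambda>z. c1 + P * indicat_real E z)"
    unfolding expected_revenue_def by (simp, intro Bochner_Integration.integral_cong) (auto simp: uniform_on_def t)
  also have "\<dots> = (c1 * (b1 * b2) + P * (b1 * P)) / (b1 * b2)"
  proof -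
    have "(indicat_real E) integrable_on D"
      using EL(1) Dm by (intro integrable_on_lebesgue_on) auto
    then have "integral D (\<lambda>z. c1 + P * indicat_real E z) = c1 * (b1 * b2) + P * (b1 * P)"
      using EL(2) mD unfolding D by (subst integral_add) (auto intro!: integrable_on_mult_right)
    then show ?thesis using integral_uniform_on(2)[OF Dm m int] mD by simp
  qed
  also have "\<dots> = c1 + P\<^sup>2 / b2"
    using assms(3,4) by (simp add: field_simps power2_eq_square)
  finally have rev: "expected_revenue (uniform_on D) (q, t) = c1 + P\<^sup>2 / b2" .
  have u: "z \<bullet> q z - t z = fst z - c1 + max 0 (snd z - P)" if "z \<in> D" for z
    using low[OF that] high[OF that] by (cases "snd z < P") (auto simp: inner_prod_def)
  have "is_mechanism D (q, t)"
    unfolding is_mechanism_def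
  proof (clarsimp simp only: case_prod_conv, intro conjI ballI)
    fix z assume "z \<in> D"
    then show "q z \<in> {0..1} \<times> {0..1}" "0 \<le> t z"
      using low[of z] high[of z] assms(1) P by (cases "snd z < P"; auto)+
  qed
  moreover have "incentive_compatible D (q, t)"
    unfolding incentive_compatible_def case_prod_conv
  proof (intro ballI)
    fix z z' assume z: "z \<in> D" "z' \<in> D"
    then have "z \<bullet> q z' - t z' \<le> fst z - c1 + max 0 (snd z - P)"
      using low[of z'] high[of z'] by (cases "snd z' < P") (auto simp: inner_prod_def)
    then show "z \<bullet> q z - t z \<ge> z \<bullet> q z' - t z'" using u[OF z(1)] by simp
  qed
  moreover have "individually_rational D (q, t)"
    unfolding individually_rational_def case_prod_conv
    using u by (auto simp: assms(5))
  moreover have "expected_revenue (uniform_on D) m' \<le> expected_revenue (uniform_on D) (q, t)"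
    if m': "is_mechanism D m'" "incentive_compatible D m'" "individually_rational D m'" for m'
  proof -
    obtain q' t' where qt: "m' = (q', t')" by (cases m')
    note mech = m'(1)[unfolded qt] and ic = m'(2)[unfolded qt] and ir = m'(3)[unfolded qt]
    have ne: "D \<noteq> {}" using assms(3,4) by (auto simp: assms(5))
    show ?thesis
    proof (cases "integrable (uniform_on D) t'")
      \<comment> \<open>The Bochner integral then defaults to 0, and the claimed revenue is
        nonnegative.\<close>
      case False
      then have "expected_revenue (uniform_on D) m' = 0"
        by (simp add: expected_revenue_def qt not_integrable_integral_eq)
      then show ?thesis using rev assms(1,4) by simp
    next
      case True
      let ?U = "indirect_utility D (q', t')"
      have "integral\<^sup>L (uniform_on D) t' \<le> (c1 + P\<^sup>2 / b2) + \<delta>" if \<delta>: "0 < \<delta>" for \<delta>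
      proof -
        \<comment> \<open>The error \<open>2 * b1 * b2 * \<epsilon>\<close>, divided by the area of
          \<open>D\<close>, becomes exactly \<delta>.\<close>
        define \<epsilon> where "\<epsilon> = \<delta> / 2"
        have \<epsilon>: "0 < \<epsilon>" using \<delta> by (simp add: \<epsilon>_def)
        define g where "g = (\<lambda>(x, y). c1 * ((?U (x + \<epsilon>, y) - ?U (x, y)) / \<epsilon>) + (x - c1)
          + (y * ((?U (x, y + \<epsilon>) - ?U (x, y)) / \<epsilon>) - ?U (x, y)))"
        \<comment> \<open>Individual rationality of the competitor enters here, on the left edge of
          \<open>D\<close>.\<close>
        have nn: "0 \<le> ?U (c1, y)" if "y \<in> {c2..c2 + b2}" for y
        proof -
          have "(c1, y) \<in> D" using that assms(3) by (simp add: assms(5))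
          then show ?thesis
            using indirect_utility_eq[OF ne mech ic] ir by (simp add: individually_rational_def)
        qed
        have g: "continuous_on UNIV g"
          "integral D g \<le> b1 * (b2 * c1 + P\<^sup>2) + 2 * b1 * b2 * \<epsilon>"
          using revenue_functional_bound[OF convex_on_indirect_utility[OF ne mech] _ nn assms(3,2,6) \<epsilon> assms(7)]
            indirect_utility_increment[OF ne mech]
          unfolding g_def P_def D by blast+
        have gi: "integrable (lebesgue_on D) g"
          unfolding D by (intro continuous_imp_integrable continuous_on_subset[OF g(1)]) auto
        have "integral\<^sup>L (uniform_on D) t' \<le> integral\<^sup>L (uniform_on D) g"
        proof (rule integral_mono[OF True integral_uniform_on(1)[OF Dm m gi]])
          fix z assume "z \<in> space (uniform_on D)"
          then have "z \<in> D" by (simp add: uniform_on_def)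
          then show "t' z \<le> g z"
            using payment_le_difference_quotients[OF ne mech ic, of "fst z" "snd z" c1 \<epsilon>] assms(1,2) \<epsilon>
            by (auto simp: g_def assms(5))
        qed
        also have "\<dots> = integral D g / (b1 * b2)"
          using integral_uniform_on(2)[OF Dm m gi] mD by simp
        also have "\<dots> \<le> (b1 * (b2 * c1 + P\<^sup>2) + 2 * b1 * b2 * \<epsilon>) / (b1 * b2)"
          using g(2) assms(3,4) by (intro divide_right_mono) auto
        also have "\<dots> = (c1 + P\<^sup>2 / b2) + \<delta>"
          using assms(3,4) by (simp add: \<epsilon>_def field_simps)
        finally show ?thesis .
      qed
      then have "integral\<^sup>L (uniform_on D) t' \<le> c1 + P\<^sup>2 / b2" by (rule field_le_epsilon)
      then show ?thesis by (simp add: rev) (simp add: expected_revenue_def qt)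
    qed
  qed
  ultimately show ?thesis by (auto simp: optimal_mechanism_def)
qed

end
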